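(* Let $G$ be a finite abstract simplicial complex and let $h: G\to\mathbb{R}$ be a function taking only positive values. Then both matrices $L=L^{--}$ and $g=SL^{++}S$ are positive definite.
   Context: A finite abstract simplicial complex $G$ is a finite set of finite non-empty sets closed under the operation of taking non-empty subsets. For $x\in G$ let $W^+(x)=\{y\in G: x\subset y\}$ and $W^-(x)=\{y\in G: y\subset x\}$ (both include $x$). Let $|x|$ be the cardinality of $x$, $\dim(x)=|x|-1$ and $\omega(x)=(-1)^{\dim(x)}$. For a function $h$ on $G$ and $A\subset G$ put $E[A]=\sum_{x\in A}h(x)$ (with $E[\emptyset]=0$). The matrices, indexed by $G\times G$, are $L^{--}(x,y)=E[W^-(x)\cap W^-(y)]$, $L^{++}(x,y)=E[W^+(x)\cap W^+(y)]$, and $S(x,y)=\omega(x)$ if $x=y$ and $0$ otherwise. Set $L=L^{--}$ and $g=SL^{++}S$. *)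

theory Defs
  imports Complex_Main
begin

definition finite_abstract_simplicial_complex :: "'a set set \<Rightarrow> bool" where
  "finite_abstract_simplicial_complex G \<longleftrightarrow>
     finite G \<and> (\<forall>x\<in>G. finite x \<and> x \<noteq> {}) \<and>
     (\<forall>x\<in>G. \<forall>y. y \<subseteq> x \<and> y \<noteq> {} \<longrightarrow> y \<in> G)"

definition W_plus :: "'a set set \<Rightarrow> 'a set \<Rightarrow> 'a set set" where
  "W_plus G x = {y \<in> G. x \<subseteq> y}"

definition W_minus :: "'a set set \<Rightarrow> 'a set \<Rightarrow> 'a set set" where
  "W_minus G x = {y \<in> G. y \<subseteq> x}"

text \<open>The truncated subtraction is harmless: simplices are finite and non-empty.\<close>

definition simplex_dim :: "'a set \<Rightarrow> nat" where
  "simplex_dim x = card x - 1"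

definition omega :: "'a set \<Rightarrow> real" where
  "omega x = (- 1) ^ simplex_dim x"

definition energy :: "('a set \<Rightarrow> real) \<Rightarrow> 'a set set \<Rightarrow> real" where
  "energy h A = (\<Sum>x\<in>A. h x)"

text \<open>A real matrix whose rows and columns are indexed by a finite set \<open>I\<close> is a function
  \<open>'i \<Rightarrow> 'i \<Rightarrow> real\<close>, of which only the entries at indices in \<open>I\<close> are meaningful.\<close>

definition mat_mult :: "'i set \<Rightarrow> ('i \<Rightarrow> 'i \<Rightarrow> real) \<Rightarrow> ('i \<Rightarrow> 'i \<Rightarrow> real) \<Rightarrow> 'i \<Rightarrow> 'i \<Rightarrow> real" where
  "mat_mult I A B = (\<lambda>i j. \<Sum>k\<in>I. A i k * B k j)"

definition positive_definite :: "'i set \<Rightarrow> ('i \<Rightarrow> 'i \<Rightarrow> real) \<Rightarrow> bool" where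
  "positive_definite I A \<longleftrightarrow>
     (\<forall>i\<in>I. \<forall>j\<in>I. A i j = A j i) \<and>
     (\<forall>v. (\<exists>i\<in>I. v i \<noteq> 0) \<longrightarrow> (\<Sum>i\<in>I. \<Sum>j\<in>I. v i * A i j * v j) > 0)"

definition L_minus_minus :: "'a set set \<Rightarrow> ('a set \<Rightarrow> real) \<Rightarrow> 'a set \<Rightarrow> 'a set \<Rightarrow> real" where
  "L_minus_minus G h = (\<lambda>x y. energy h (W_minus G x \<inter> W_minus G y))"

definition L_plus_plus :: "'a set set \<Rightarrow> ('a set \<Rightarrow> real) \<Rightarrow> 'a set \<Rightarrow> 'a set \<Rightarrow> real" where
  "L_plus_plus G h = (\<lambda>x y. energy h (W_plus G x \<inter> W_plus G y))"

definition S_matrix :: "'a set \<Rightarrow> 'a set \<Rightarrow> real" where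
  "S_matrix = (\<lambda>x y. if x = y then omega x else 0)"

definition g_matrix :: "'a set set \<Rightarrow> ('a set \<Rightarrow> real) \<Rightarrow> 'a set \<Rightarrow> 'a set \<Rightarrow> real" where
  "g_matrix G h = mat_mult G (mat_mult G S_matrix (L_plus_plus G h)) S_matrix"

end

theory Submission
  imports Defs
begin

text \<open>
  Both \<open>L\<close> and \<open>g\<close> are congruent to the diagonal matrix of the weights \<open>h\<close>. Writing \<open>Z\<close> for the
  incidence matrix of the face relation, \<open>L = Z\<^sup>T diag(h) Z\<close> and \<open>L\<^sup>+\<^sup>+ = Z diag(h) Z\<^sup>T\<close>, because
  the energy of an intersection of two cones counts each common face (or coface) once with its
  weight. Hence the quadratic form of such a matrix at \<open>v\<close> is a sum of squares with positive weights,
  and it can only vanish if the image of \<open>v\<close> under the incidence matrix vanishes. That matrix is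
  unitriangular for any order of the simplices that refines inclusion: at an extremal simplex of
  the support of \<open>v\<close>, the image of \<open>v\<close> is the entry of \<open>v\<close> itself, which is not zero.

  The lemma \<open>positive_definite_order_kernel\<close> carries this argument for an arbitrary finite partial
  order; inclusion gives \<open>L\<close> and reverse inclusion gives \<open>L\<^sup>+\<^sup>+\<close>. Passing from \<open>L\<^sup>+\<^sup>+\<close> to
  \<open>g = S L\<^sup>+\<^sup>+ S\<close> is one more congruence, by an invertible diagonal matrix
  (\<open>positive_definite_diagonal_congruence\<close>).
\<close>

text \<open>
  This is the factorization \<open>Z\<^sup>T diag(h) Z\<close> of the kernel, read as a quadratic form: expressing the
  two membership conditions by 0-1 factors decouples \<open>i\<close> from \<open>j\<close> once the sum over \<open>k\<close> is moved outside.
\<close>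

lemma incidence_quadratic_form:
  fixes h v :: "'i \<Rightarrow> real"
  assumes "finite I"
  shows "(\<Sum>i\<in>I. \<Sum>j\<in>I. v i * (\<Sum>k | k \<in> I \<and> R k i \<and> R k j. h k) * v j)
       = (\<Sum>k\<in>I. h k * (\<Sum>i | i \<in> I \<and> R k i. v i)\<^sup>2)"
proof -
  define z :: "'i \<Rightarrow> 'i \<Rightarrow> real" where "z k i = (if R k i then 1 else 0)" for k i
  have kernel: "(\<Sum>k | k \<in> I \<and> R k i \<and> R k j. h k) = (\<Sum>k\<in>I. h k * z k i * z k j)" for i j
    using assms by (intro sum.mono_neutral_cong_left) (auto simp: z_def split: if_splits)
  have image: "(\<Sum>i | i \<in> I \<and> R k i. v i) = (\<Sum>i\<in>I. z k i * v i)" for k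
    using assms by (intro sum.mono_neutral_cong_left) (auto simp: z_def split: if_splits)
  have "(\<Sum>i\<in>I. \<Sum>j\<in>I. v i * (\<Sum>k | k \<in> I \<and> R k i \<and> R k j. h k) * v j)
      = (\<Sum>i\<in>I. \<Sum>j\<in>I. \<Sum>k\<in>I. h k * ((z k i * v i) * (z k j * v j)))"
    by (simp add: kernel sum_distrib_left sum_distrib_right mult_ac)
  also have "\<dots> = (\<Sum>i\<in>I. \<Sum>k\<in>I. \<Sum>j\<in>I. h k * ((z k i * v i) * (z k j * v j)))"
    by (intro sum.cong refl sum.swap)
  also have "\<dots> = (\<Sum>k\<in>I. \<Sum>i\<in>I. \<Sum>j\<in>I. h k * ((z k i * v i) * (z k j * v j)))"
    by (rule sum.swap)
  also have "\<dots> = (\<Sum>k\<in>I. h k * (\<Sum>i | i \<in> I \<and> R k i. v i)\<^sup>2)"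
    by (simp only: image power2_eq_square sum_product) (simp only: sum_distrib_left)
  finally show ?thesis .
qed

text \<open>
  The form is a weighted sum of squares. Reflexivity and maximality of \<open>m\<close> in the support of \<open>v\<close>
  make the square at \<open>m\<close> equal to that of the single entry \<open>v m\<close>, so one summand is positive.
\<close>

lemma positive_definite_order_kernel:
  fixes h :: "'i \<Rightarrow> real"
  assumes "finite I" and pos: "\<And>k. k \<in> I \<Longrightarrow> h k > 0"
    and refl: "\<And>i. R i i" and trans: "transp R" and antisym: "antisymp R"
  shows "positive_definite I (\<lambda>i j. \<Sum>k | k \<in> I \<and> R k i \<and> R k j. h k)"
  unfolding positive_definite_def
proof (intro conjI ballI allI impI)
  fix i j
  show "(\<Sum>k | k \<in> I \<and> R k i \<and> R k j. h k) = (\<Sum>k | k \<in> I \<and> R k j \<and> R k i. h k)"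
    by (simp add: conj_commute)
next
  fix v :: "'i \<Rightarrow> real"
  assume "\<exists>i\<in>I. v i \<noteq> 0"
  then have "{i \<in> I. v i \<noteq> 0} \<noteq> {}" by blast
  moreover have "transp_on {i \<in> I. v i \<noteq> 0} (\<lambda>i j. R i j \<and> i \<noteq> j)"
    using trans antisym by (auto intro!: transp_onI dest: transpD antisympD)
  moreover have "asymp_on {i \<in> I. v i \<noteq> 0} (\<lambda>i j. R i j \<and> i \<noteq> j)"
    using antisym by (auto intro!: asymp_onI dest: antisympD)
  ultimately obtain m where m: "m \<in> I" "v m \<noteq> 0"
    and max: "\<And>i. i \<in> I \<Longrightarrow> v i \<noteq> 0 \<Longrightarrow> R m i \<Longrightarrow> i = m"
    using Finite_Set.bex_max_element[of "{i \<in> I. v i \<noteq> 0}" "\<lambda>i j. R i j \<and> i \<noteq> j"] \<open>finite I\<close>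
    by auto
  have "(\<Sum>i | i \<in> I \<and> R m i. v i) = (\<Sum>i\<in>{m}. v i)"
    using \<open>finite I\<close> m refl max by (intro sum.mono_neutral_right) auto
  then have "0 < h m * (\<Sum>i | i \<in> I \<and> R m i. v i)\<^sup>2"
    using m pos by simp
  then have "0 < (\<Sum>k\<in>I. h k * (\<Sum>i | i \<in> I \<and> R k i. v i)\<^sup>2)"
    using \<open>finite I\<close> m(1) pos by (intro sum_pos2[of I m]) (auto simp: less_imp_le)
  then show "0 < (\<Sum>i\<in>I. \<Sum>j\<in>I. v i * (\<Sum>k | k \<in> I \<and> R k i \<and> R k j. h k) * v j)"
    using \<open>finite I\<close> by (simp add: incidence_quadratic_form)
qed

lemma positive_definite_diagonal_congruence:
  fixes A B :: "'i \<Rightarrow> 'i \<Rightarrow> real" and d :: "'i \<Rightarrow> real"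
  assumes A: "positive_definite I A" and d: "\<And>i. i \<in> I \<Longrightarrow> d i \<noteq> 0"
    and B: "\<And>i j. i \<in> I \<Longrightarrow> j \<in> I \<Longrightarrow> B i j = d i * A i j * d j"
  shows "positive_definite I B"
  unfolding positive_definite_def
proof (intro conjI ballI allI impI)
  fix i j assume "i \<in> I" "j \<in> I"
  then show "B i j = B j i"
    using A by (auto simp: positive_definite_def B mult_ac)
next
  fix v :: "'i \<Rightarrow> real"
  assume "\<exists>i\<in>I. v i \<noteq> 0"
  then have "\<exists>i\<in>I. d i * v i \<noteq> 0" using d by auto
  then have "0 < (\<Sum>i\<in>I. \<Sum>j\<in>I. (d i * v i) * A i j * (d j * v j))"
    using A[unfolded positive_definite_def, THEN conjunct2, THEN spec[of _ "\<lambda>i. d i * v i"]] by simp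
  also have "\<dots> = (\<Sum>i\<in>I. \<Sum>j\<in>I. v i * B i j * v j)"
    by (intro sum.cong refl) (simp add: B)
  finally show "0 < (\<Sum>i\<in>I. \<Sum>j\<in>I. v i * B i j * v j)" .
qed

lemma g_matrix_entry:
  assumes "finite G" "x \<in> G" "y \<in> G"
  shows "g_matrix G h x y = omega x * L_plus_plus G h x y * omega y"
  using assms
  by (simp add: g_matrix_def mat_mult_def S_matrix_def if_distrib[of "\<lambda>t. t * _"]
      if_distrib[of "\<lambda>t. _ * t"] sum.delta sum.delta' cong: if_cong)

theorem corollary2:
  fixes G :: "'a set set" and h :: "'a set \<Rightarrow> real"
  assumes "finite_abstract_simplicial_complex G"
    and "\<And>x. x \<in> G \<Longrightarrow> h x > 0"
  shows "positive_definite G (L_minus_minus G h) \<and> positive_definite G (g_matrix G h)"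
proof
  have fin: "finite G"
    using assms(1) by (simp add: finite_abstract_simplicial_complex_def)
  have "W_minus G x \<inter> W_minus G y = {z. z \<in> G \<and> z \<subseteq> x \<and> z \<subseteq> y}" for x y
    by (auto simp: W_minus_def)
  then show "positive_definite G (L_minus_minus G h)"
    using positive_definite_order_kernel[of G h "(\<subseteq>)"] fin assms(2)
    by (simp add: L_minus_minus_def energy_def transp_def antisymp_def)
  have "W_plus G x \<inter> W_plus G y = {z. z \<in> G \<and> z \<supseteq> x \<and> z \<supseteq> y}" for x y
    by (auto simp: W_plus_def)
  then have "positive_definite G (L_plus_plus G h)"
    using positive_definite_order_kernel[of G h "(\<supseteq>)"] fin assms(2)
    by (simp add: L_plus_plus_def energy_def)
  then show "positive_definite G (g_matrix G h)"
    by (rule positive_definite_diagonal_congruence[where d = omega])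
      (simp_all add: omega_def g_matrix_entry fin)
qed

end
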